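(* There exists an archimedean $\ell$-group $H$ with a strong unit $v$ such that $H\in(\mathrm{M})$ and the Yosida space $Y(H,v)$ is not zero-dimensional.
   Context: $\ell$-group means lattice-ordered group (written additively). $H$ is archimedean if whenever $a,b\ge 0$ and $na\le b$ for all $n\in\mathbb{N}$, then $a=0$. For $a\in H$, $H(a)=\{b\in H:|b|\le n|a|\text{ for some }n\in\mathbb{N}\}$ is the principal convex $\ell$-subgroup generated by $a$; a strong unit is $v\ge 0$ with $H(v)=H$. For $S\subseteq H$, $S^\perp=\{h\in H:|h|\wedge|s|=0\text{ for all }s\in S\}$. $H\in(\mathrm{M})$ means that every convex $\ell$-subgroup $K$ of $H$ satisfies $a^{\perp\perp}\subseteq K$ for all $a\in K$; equivalently $H(a)=a^{\perp\perp}$ for all $a\in H$. The Yosida space $Y(H,v)$ is the set of values of $v$ (convex $\ell$-subgroups of $H$ maximal with respect to not containing $v$) with the hull-kernel topology, whose base is given by the sets $\{p\in Y(H,v):a\notin p\}$, $a\in H$; it is a compact Hausdorff space. A space is zero-dimensional if it has a base of clopen sets. *)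

theory Defs
  imports "HOL-Analysis.Analysis" "HOL-Algebra.Group"
begin

text \<open>
  Lattice-ordered groups are built on the library's (multiplicatively written) commutative
  groups and its carrier-based lattices.  Dictionary to additive notation:
  \<open>x \<otimes> y\<close> is \<open>x + y\<close>, \<open>\<one>\<close> is \<open>0\<close>, \<open>inv x\<close> is \<open>- x\<close>, \<open>x [^] n\<close> is \<open>n x\<close>.
  Commutativity is included in the notion; archimedean lattice-ordered groups are commutative
  in any case.
\<close>

record 'a lgroup = "'a monoid" +
  leq :: "'a \<Rightarrow> 'a \<Rightarrow> bool"  (infix \<open>\<preceq>\<index>\<close> 50)

definition lorder :: "('a, 'm) lgroup_scheme \<Rightarrow> 'a gorder" where
  "lorder G = \<lparr>carrier = carrier G, eq = (=), le = leq G\<rparr>"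

locale lattice_ordered_group =
  comm_group G + lat?: lattice "lorder G" for G :: "('a, 'm) lgroup_scheme" (structure) +
  assumes translation_mono:
    "\<lbrakk>x \<preceq> y; x \<in> carrier G; y \<in> carrier G; z \<in> carrier G\<rbrakk> \<Longrightarrow> x \<otimes> z \<preceq> y \<otimes> z"

definition lmeet :: "('a, 'm) lgroup_scheme \<Rightarrow> 'a \<Rightarrow> 'a \<Rightarrow> 'a" where
  "lmeet G x y = x \<sqinter>\<^bsub>lorder G\<^esub> y"

definition ljoin :: "('a, 'm) lgroup_scheme \<Rightarrow> 'a \<Rightarrow> 'a \<Rightarrow> 'a" where
  "ljoin G x y = x \<squnion>\<^bsub>lorder G\<^esub> y"

definition labs :: "('a, 'm) lgroup_scheme \<Rightarrow> 'a \<Rightarrow> 'a" where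
  "labs G x = ljoin G x (inv\<^bsub>G\<^esub> x)"

definition archimedean :: "('a, 'm) lgroup_scheme \<Rightarrow> bool" where
  "archimedean G \<longleftrightarrow>
    (\<forall>a \<in> carrier G. \<forall>b \<in> carrier G.
       \<one>\<^bsub>G\<^esub> \<preceq>\<^bsub>G\<^esub> a \<and> \<one>\<^bsub>G\<^esub> \<preceq>\<^bsub>G\<^esub> b \<and> (\<forall>n::nat. a [^]\<^bsub>G\<^esub> n \<preceq>\<^bsub>G\<^esub> b) \<longrightarrow> a = \<one>\<^bsub>G\<^esub>)"

definition convex_lsubgroup :: "'a set \<Rightarrow> ('a, 'm) lgroup_scheme \<Rightarrow> bool" where
  "convex_lsubgroup K G \<longleftrightarrow>
    subgroup K G \<and>
    (\<forall>x \<in> K. \<forall>y \<in> K. lmeet G x y \<in> K \<and> ljoin G x y \<in> K) \<and>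
    (\<forall>x \<in> K. \<forall>y \<in> K. \<forall>z \<in> carrier G. x \<preceq>\<^bsub>G\<^esub> z \<and> z \<preceq>\<^bsub>G\<^esub> y \<longrightarrow> z \<in> K)"

definition principal_convex :: "('a, 'm) lgroup_scheme \<Rightarrow> 'a \<Rightarrow> 'a set" where
  "principal_convex G a = {b \<in> carrier G. \<exists>n::nat. labs G b \<preceq>\<^bsub>G\<^esub> labs G a [^]\<^bsub>G\<^esub> n}"

definition strong_unit :: "('a, 'm) lgroup_scheme \<Rightarrow> 'a \<Rightarrow> bool" where
  "strong_unit G v \<longleftrightarrow>
    v \<in> carrier G \<and> \<one>\<^bsub>G\<^esub> \<preceq>\<^bsub>G\<^esub> v \<and> principal_convex G v = carrier G"

definition polar :: "('a, 'm) lgroup_scheme \<Rightarrow> 'a set \<Rightarrow> 'a set" where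
  "polar G S = {h \<in> carrier G. \<forall>s \<in> S. lmeet G (labs G h) (labs G s) = \<one>\<^bsub>G\<^esub>}"

definition property_M :: "('a, 'm) lgroup_scheme \<Rightarrow> bool" where
  "property_M G \<longleftrightarrow>
    (\<forall>K. convex_lsubgroup K G \<longrightarrow> (\<forall>a \<in> K. polar G (polar G {a}) \<subseteq> K))"

definition group_values :: "('a, 'm) lgroup_scheme \<Rightarrow> 'a \<Rightarrow> 'a set set" where
  "group_values G v =
    {p. convex_lsubgroup p G \<and> v \<notin> p \<and>
        (\<forall>q. convex_lsubgroup q G \<and> v \<notin> q \<and> p \<subseteq> q \<longrightarrow> q = p)}"

text \<open>The generating family covers \<open>group_values G v\<close> (take \<open>a = v\<close>) and, for a
  lattice-ordered group, is closed under finite intersections, so it is a base.\<close>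

definition yosida_space :: "('a, 'm) lgroup_scheme \<Rightarrow> 'a \<Rightarrow> 'a set topology" where
  "yosida_space G v = topology_generated_by {{p \<in> group_values G v. a \<notin> p} | a. a \<in> carrier G}"

definition zero_dimensional :: "'a topology \<Rightarrow> bool" where
  "zero_dimensional X \<longleftrightarrow>
    (\<exists>\<B>. (\<forall>U \<in> \<B>. openin X U \<and> closedin X U) \<and>
         openin X = (arbitrary union_of (\<lambda>U. U \<in> \<B>)))"

end

theory Submission
  imports Defs
begin

text \<open>Let \<open>H\<close> consist of the functions on \<open>nat \<Rightarrow> real\<close> that agree, off a finite set, with
  \<open>x \<mapsto> f (x 0)\<close> for some piecewise linear \<open>f\<close> on \<open>[0, 1]\<close> (extended by constants to the line).
  Every fibre \<open>{x. x 0 = t}\<close> is infinite, so \<open>f\<close> is determined by the function.  Property (M) holds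
  because \<open>b \<in> a\<^sup>\<bottom>\<^sup>\<bottom>\<close> forces every zero of \<open>a\<close> to be a zero of \<open>b\<close> (test with point
  indicators), hence, by infinite fibres, the same inclusion for the piecewise linear parts, and
  for piecewise linear functions on a compact interval this yields \<open>\<bar>b\<bar> \<le> n \<bar>a\<bar>\<close>.  On the other
  hand \<open>t \<mapsto> {h. f t = 0}\<close> maps the connected space \<open>[0, 1]\<close> continuously into the Yosida space,
  and not to a single point.\<close>

section \<open>Piecewise linear functions\<close>

text \<open>A local form of piecewise linearity: on each side of every point the graph is a line
  segment starting at \<open>(t, f t)\<close>. Using the value \<open>f t\<close> itself builds
  continuity in. By compactness there are finitely many pieces on a bounded interval, but only the
  germs are used.\<close>

definition piecewise_linear :: "(real \<Rightarrow> real) \<Rightarrow> bool" where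
  "piecewise_linear f \<longleftrightarrow>
    (\<forall>t. \<forall>F \<in> {at_left t, at_right t}. \<exists>c. \<forall>\<^sub>F s in F. f s = f t + c * (s - t))"

lemma piecewise_linear_affine: "piecewise_linear (\<lambda>s. m * s + k)"
  unfolding piecewise_linear_def
  by (intro allI ballI exI[of _ m] always_eventually) (simp add: algebra_simps)

lemma piecewise_linear_add:
  assumes "piecewise_linear f" "piecewise_linear g"
  shows "piecewise_linear (\<lambda>s. f s + g s)"
  unfolding piecewise_linear_def
proof (intro allI ballI)
  fix t :: real and F assume F: "F \<in> {at_left t, at_right t}"
  obtain c d where "\<forall>\<^sub>F s in F. f s = f t + c * (s - t)" "\<forall>\<^sub>F s in F. g s = g t + d * (s - t)"
    using assms F unfolding piecewise_linear_def by metis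
  then have "\<forall>\<^sub>F s in F. f s + g s = f t + g t + (c + d) * (s - t)"
    by eventually_elim (simp add: algebra_simps)
  then show "\<exists>c. \<forall>\<^sub>F s in F. f s + g s = f t + g t + c * (s - t)" by blast
qed

lemma piecewise_linear_scale:
  assumes "piecewise_linear f"
  shows "piecewise_linear (\<lambda>s. k * f s)"
  unfolding piecewise_linear_def
proof (intro allI ballI)
  fix t :: real and F assume F: "F \<in> {at_left t, at_right t}"
  obtain c where "\<forall>\<^sub>F s in F. f s = f t + c * (s - t)"
    using assms F unfolding piecewise_linear_def by metis
  then have "\<forall>\<^sub>F s in F. k * f s = k * f t + (k * c) * (s - t)"
    by eventually_elim (simp add: distrib_left)
  then show "\<exists>c. \<forall>\<^sub>F s in F. k * f s = k * f t + c * (s - t)" by blast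
qed

lemma piecewise_linear_tendsto:
  assumes "piecewise_linear f" "F \<in> {at_left t, at_right t}"
  shows "(f \<longlongrightarrow> f t) F"
proof -
  obtain c where c: "\<forall>\<^sub>F s in F. f s = f t + c * (s - t)"
    using assms unfolding piecewise_linear_def by metis
  have "(id \<longlongrightarrow> t) F"
    using assms(2) by (auto simp: id_def)
  then have "((\<lambda>s. f t + c * (s - t)) \<longlongrightarrow> f t + c * (t - t)) F"
    unfolding id_def by (intro tendsto_intros)
  then show ?thesis
    using c by (simp add: tendsto_cong)
qed

lemma piecewise_linear_isCont:
  assumes "piecewise_linear f"
  shows "isCont f t"
  using piecewise_linear_tendsto[OF assms]
  by (simp add: isCont_def filterlim_at_split)

lemma piecewise_linear_abs:
  assumes "piecewise_linear f"
  shows "piecewise_linear (\<lambda>s. \<bar>f s\<bar>)"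
  unfolding piecewise_linear_def
proof (intro allI ballI)
  fix t :: real and F assume F: "F \<in> {at_left t, at_right t}"
  obtain c where c: "\<forall>\<^sub>F s in F. f s = f t + c * (s - t)"
    using assms F unfolding piecewise_linear_def by metis
  note lim = piecewise_linear_tendsto[OF assms F]
  consider "f t > 0" | "f t < 0" | "f t = 0" by linarith
  then show "\<exists>c. \<forall>\<^sub>F s in F. \<bar>f s\<bar> = \<bar>f t\<bar> + c * (s - t)"
  proof cases
    case 1
    have "\<forall>\<^sub>F s in F. \<bar>f s\<bar> = \<bar>f t\<bar> + c * (s - t)"
      using order_tendstoD(1)[OF lim 1] c by eventually_elim (use 1 in auto)
    then show ?thesis by blast
  next
    case 2
    have "\<forall>\<^sub>F s in F. \<bar>f s\<bar> = \<bar>f t\<bar> + (- c) * (s - t)"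
      using order_tendstoD(2)[OF lim 2] c by eventually_elim (use 2 in auto)
    then show ?thesis by blast
  next
    case 3
    \<comment> \<open>The constant sign of \<open>s - t\<close> on the chosen side. At a zero of
      \<open>f\<close> the absolute value has one-sided slope \<open>\<bar>c\<bar> * e\<close>,
      which is why the two sides are treated separately in the definition.\<close>
    define e :: real where "e = (if F = at_right t then 1 else -1)"
    have "\<forall>\<^sub>F s in F. \<bar>s - t\<bar> = e * (s - t)"
    proof (cases "F = at_right t")
      case True
      have "\<forall>\<^sub>F s in at_right t. t < s" by (simp add: eventually_at_filter)
      then show ?thesis unfolding True e_def by eventually_elim simp
    next
      case False
      then have "F = at_left t" using F by simp
      moreover have "\<forall>\<^sub>F s in at_left t. s < t" by (simp add: eventually_at_filter)
      ultimately show ?thesis using False unfolding e_def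
        by (auto elim: eventually_mono)
    qed
    then have "\<forall>\<^sub>F s in F. \<bar>f s\<bar> = \<bar>f t\<bar> + (\<bar>c\<bar> * e) * (s - t)"
      using c by eventually_elim (simp add: 3 abs_mult)
    then show ?thesis by blast
  qed
qed

text \<open>At a zero of \<open>f\<close> both germs are linear through 0. A nonzero slope of
  \<open>f\<close> bounds \<open>g\<close> by the ratio of slopes; a zero slope makes
  \<open>f\<close>, hence \<open>g\<close>, vanish on that side. Away from zeros of
  \<open>f\<close>, continuity suffices. For merely continuous functions this fails, e.g. for the
  square root of \<open>\<bar>s\<bar>\<close> against \<open>s\<close> at 0.\<close>

lemma piecewise_linear_locally_dominated:
  assumes f: "piecewise_linear f" and g: "piecewise_linear g"
    and zero: "\<And>t. f t = 0 \<Longrightarrow> g t = 0"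
    and F: "F \<in> {at_left t, at_right t}"
  shows "\<exists>n::nat. \<forall>\<^sub>F s in F. \<bar>g s\<bar> \<le> n * \<bar>f s\<bar>"
proof (cases "f t = 0")
  case True
  obtain c d where c: "\<forall>\<^sub>F s in F. f s = f t + c * (s - t)"
    and d: "\<forall>\<^sub>F s in F. g s = g t + d * (s - t)"
    using f g F unfolding piecewise_linear_def by metis
  show ?thesis
  proof (cases "c = 0")
    case True
    have "\<forall>\<^sub>F s in F. \<bar>g s\<bar> \<le> real 0 * \<bar>f s\<bar>"
      using c by eventually_elim (use True zero \<open>f t = 0\<close> in auto)
    then show ?thesis by blast
  next
    case False
    obtain n :: nat where n: "\<bar>d\<bar> / \<bar>c\<bar> \<le> n" using real_arch_simple by blast
    then have dn: "\<bar>d\<bar> \<le> n * \<bar>c\<bar>" using False by (simp add: field_simps)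
    have "\<forall>\<^sub>F s in F. \<bar>g s\<bar> \<le> n * \<bar>f s\<bar>"
      using c d
    proof eventually_elim
      case (elim s)
      have "\<bar>d\<bar> * \<bar>s - t\<bar> \<le> n * \<bar>c\<bar> * \<bar>s - t\<bar>" using dn by (rule mult_right_mono) simp
      then show ?case using elim \<open>f t = 0\<close> zero by (simp add: abs_mult mult.assoc)
    qed
    then show ?thesis by blast
  qed
next
  case False
  obtain n :: nat where n: "\<bar>g t\<bar> / \<bar>f t\<bar> < n" using reals_Archimedean2 by blast
  then have lt: "0 < n * \<bar>f t\<bar> - \<bar>g t\<bar>" using False by (simp add: field_simps)
  have "((\<lambda>s. n * \<bar>f s\<bar> - \<bar>g s\<bar>) \<longlongrightarrow> n * \<bar>f t\<bar> - \<bar>g t\<bar>) F"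
    using piecewise_linear_tendsto f g F by (intro tendsto_intros)
  from order_tendstoD(1)[OF this lt] have "\<forall>\<^sub>F s in F. \<bar>g s\<bar> \<le> n * \<bar>f s\<bar>"
    by eventually_elim simp
  then show ?thesis by blast
qed

text \<open>Bisection stands in for compactness: the existence of a bound passes to adjoining
  intervals, by adding the constants, and holds on all short intervals around each point.\<close>

lemma piecewise_linear_dominated:
  assumes f: "piecewise_linear f" and g: "piecewise_linear g"
    and zero: "\<And>t. f t = 0 \<Longrightarrow> g t = 0" and "u \<le> w"
  shows "\<exists>n::nat. \<forall>s \<in> {u..w}. \<bar>g s\<bar> \<le> n * \<bar>f s\<bar>"
proof (rule Bolzano[where P = "\<lambda>u w. \<exists>n::nat. \<forall>s \<in> {u..w}. \<bar>g s\<bar> \<le> n * \<bar>f s\<bar>"])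
  show "u \<le> w" by fact
next
  fix a b c
  assume "\<exists>n::nat. \<forall>s \<in> {a..b}. \<bar>g s\<bar> \<le> n * \<bar>f s\<bar>" "\<exists>n::nat. \<forall>s \<in> {b..c}. \<bar>g s\<bar> \<le> n * \<bar>f s\<bar>"
  then obtain m n :: nat where mn: "\<forall>s \<in> {a..b}. \<bar>g s\<bar> \<le> m * \<bar>f s\<bar>" "\<forall>s \<in> {b..c}. \<bar>g s\<bar> \<le> n * \<bar>f s\<bar>"
    by blast
  have "\<bar>g s\<bar> \<le> (m + n) * \<bar>f s\<bar>" if "s \<in> {a..c}" for s
  proof -
    have "\<bar>g s\<bar> \<le> m * \<bar>f s\<bar> \<or> \<bar>g s\<bar> \<le> n * \<bar>f s\<bar>" using mn that by force
    moreover have "0 \<le> m * \<bar>f s\<bar>" "0 \<le> n * \<bar>f s\<bar>" by simp_all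
    ultimately show ?thesis unfolding of_nat_add distrib_right by linarith
  qed
  then show "\<exists>n::nat. \<forall>s \<in> {a..c}. \<bar>g s\<bar> \<le> n * \<bar>f s\<bar>" by blast
next
  fix t
  obtain m n :: nat where "\<forall>\<^sub>F s in at_left t. \<bar>g s\<bar> \<le> m * \<bar>f s\<bar>"
      "\<forall>\<^sub>F s in at_right t. \<bar>g s\<bar> \<le> n * \<bar>f s\<bar>"
    using piecewise_linear_locally_dominated[OF f g zero] by blast
  then obtain l r where l: "l < t" "\<forall>s>l. s < t \<longrightarrow> \<bar>g s\<bar> \<le> m * \<bar>f s\<bar>"
    and r: "t < r" "\<forall>s>t. s < r \<longrightarrow> \<bar>g s\<bar> \<le> n * \<bar>f s\<bar>"
    unfolding eventually_at_left_field eventually_at_right_field by blast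
  \<comment> \<open>The one-sided filters omit \<open>t\<close> itself, so a third constant covers
    that point.\<close>
  obtain k :: nat where k: "\<bar>g t\<bar> \<le> k * \<bar>f t\<bar>"
  proof (cases "f t = 0")
    case True
    then show ?thesis using that[of 0] zero by simp
  next
    case False
    obtain k :: nat where "\<bar>g t\<bar> / \<bar>f t\<bar> \<le> k" using real_arch_simple by blast
    then show ?thesis using that[of k] False by (simp add: field_simps)
  qed
  have *: "\<bar>g s\<bar> \<le> (m + n + k) * \<bar>f s\<bar>" if "l < s" "s < r" for s
  proof -
    have "\<bar>g s\<bar> \<le> m * \<bar>f s\<bar> \<or> \<bar>g s\<bar> \<le> n * \<bar>f s\<bar> \<or> \<bar>g s\<bar> \<le> k * \<bar>f s\<bar>"
      using l(2) r(2) k that by (metis linorder_neqE_linordered_idom)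
    moreover have "0 \<le> m * \<bar>f s\<bar>" "0 \<le> n * \<bar>f s\<bar>" "0 \<le> k * \<bar>f s\<bar>" by simp_all
    ultimately show ?thesis unfolding of_nat_add distrib_right by linarith
  qed
  show "\<exists>d>0. \<forall>a b. a \<le> t \<and> t \<le> b \<and> b - a < d \<longrightarrow> (\<exists>n::nat. \<forall>s \<in> {a..b}. \<bar>g s\<bar> \<le> n * \<bar>f s\<bar>)"
  proof (intro exI[of _ "min (t - l) (r - t)"] conjI allI impI)
    fix a b assume "a \<le> t \<and> t \<le> b \<and> b - a < min (t - l) (r - t)"
    then have "\<forall>s \<in> {a..b}. \<bar>g s\<bar> \<le> real (m + n + k) * \<bar>f s\<bar>"
      using * by (auto simp: min_less_iff_conj simp flip: of_nat_add)
    then show "\<exists>n::nat. \<forall>s \<in> {a..b}. \<bar>g s\<bar> \<le> n * \<bar>f s\<bar>" by blast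
  qed (use l r in auto)
qed


section \<open>The group\<close>

text \<open>The clamping equation encodes functions on the unit interval as total functions on the
  line, so that equality of functions is plain equality and bounds on \<open>{0..1}\<close> are
  global.\<close>

definition pl_funs :: "(real \<Rightarrow> real) set" where
  "pl_funs = {f. piecewise_linear f \<and> (\<forall>s. f s = f (max 0 (min 1 s)))}"

lemma pl_funs_const: "(\<lambda>s. k) \<in> pl_funs"
  using piecewise_linear_affine[of 0 k] by (simp add: pl_funs_def)

lemma pl_funs_add: "f \<in> pl_funs \<Longrightarrow> g \<in> pl_funs \<Longrightarrow> (\<lambda>s. f s + g s) \<in> pl_funs"
  unfolding pl_funs_def by (auto intro: piecewise_linear_add)

lemma pl_funs_scale: "f \<in> pl_funs \<Longrightarrow> (\<lambda>s. k * f s) \<in> pl_funs"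
  unfolding pl_funs_def by (auto intro: piecewise_linear_scale)

lemma pl_funs_abs: "f \<in> pl_funs \<Longrightarrow> (\<lambda>s. \<bar>f s\<bar>) \<in> pl_funs"
  unfolding pl_funs_def by (auto intro: piecewise_linear_abs)

lemma pl_funs_clamp: "(\<lambda>s. max 0 (min 1 s)) \<in> pl_funs"
proof -
  \<comment> \<open>The difference of \<open>\<bar>s\<bar>\<close> and
    \<open>\<bar>s - 1\<bar>\<close> is -1, \<open>2 * s - 1\<close> and 1 on the three ranges. The
    affine terms are spelled out to match the closure rules.\<close>
  have eq: "(\<lambda>s::real. max 0 (min 1 s)) = (\<lambda>s. (1/2) * (\<bar>1 * s + 0\<bar> + (- 1) * \<bar>1 * s + (- 1)\<bar>) + 1/2)"
    by (auto simp: fun_eq_iff max_def min_def abs_if field_simps)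
  have "piecewise_linear (\<lambda>s. max 0 (min 1 s))"
    unfolding eq using piecewise_linear_affine[of 0 "1/2"]
    by (intro piecewise_linear_add piecewise_linear_scale piecewise_linear_abs piecewise_linear_affine)
      simp
  then show ?thesis by (simp add: pl_funs_def)
qed

lemma pl_funs_dominated:
  assumes f: "f \<in> pl_funs" and g: "g \<in> pl_funs" and "\<And>t. f t = 0 \<Longrightarrow> g t = 0"
  shows "\<exists>n::nat. \<forall>s. \<bar>g s\<bar> \<le> n * \<bar>f s\<bar>"
proof -
  obtain n :: nat where n: "\<forall>s \<in> {0..1}. \<bar>g s\<bar> \<le> n * \<bar>f s\<bar>"
    using piecewise_linear_dominated[of f g 0 1] assms by (auto simp: pl_funs_def)
  have "\<bar>g s\<bar> \<le> n * \<bar>f s\<bar>" for s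
  proof -
    have "f s = f (max 0 (min 1 s))" "g s = g (max 0 (min 1 s))"
      using f g by (simp_all add: pl_funs_def)
    then show ?thesis using n by simp
  qed
  then show ?thesis by blast
qed

text \<open>Only coordinate 0 carries the geometry; the other coordinates make every fibre over it
  infinite, so that changing finitely many values cannot hide \<open>f\<close>.\<close>

definition pl_part :: "((nat \<Rightarrow> real) \<Rightarrow> real) \<Rightarrow> (real \<Rightarrow> real) \<Rightarrow> bool" where
  "pl_part h f \<longleftrightarrow> f \<in> pl_funs \<and> finite {x. h x \<noteq> f (x 0)}"

definition HG :: "((nat \<Rightarrow> real) \<Rightarrow> real) lgroup" where
  "HG = \<lparr>carrier = {h. \<exists>f. pl_part h f}, mult = (\<lambda>g h x. g x + h x), one = (\<lambda>x. 0), leq = (\<le>)\<rparr>"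

lemma HG_simps [simp]:
  "mult HG g h = (\<lambda>x. g x + h x)" "one HG = (\<lambda>x. 0)" "leq HG = (\<le>)"
  by (simp_all add: HG_def)

lemma carrier_HG: "h \<in> carrier HG \<longleftrightarrow> (\<exists>f. pl_part h f)"
  by (simp add: HG_def)

section \<open>Operations on finite modifications of piecewise linear functions\<close>

lemma pl_part_add: "pl_part g e \<Longrightarrow> pl_part h f \<Longrightarrow> pl_part (\<lambda>x. g x + h x) (\<lambda>s. e s + f s)"
  unfolding pl_part_def
  by (auto intro: pl_funs_add
      intro!: finite_subset[of _ "{x. g x \<noteq> e (x 0)} \<union> {x. h x \<noteq> f (x 0)}"])

lemma pl_part_scale: "pl_part h f \<Longrightarrow> pl_part (\<lambda>x. k * h x) (\<lambda>s. k * f s)"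
  unfolding pl_part_def
  by (auto intro: pl_funs_scale intro!: finite_subset[of _ "{x. h x \<noteq> f (x 0)}"])

lemma pl_part_abs: "pl_part h f \<Longrightarrow> pl_part (\<lambda>x. \<bar>h x\<bar>) (\<lambda>s. \<bar>f s\<bar>)"
  unfolding pl_part_def
  by (auto intro: pl_funs_abs intro!: finite_subset[of _ "{x. h x \<noteq> f (x 0)}"])

lemma pl_part_max:
  assumes "pl_part g e" "pl_part h f"
  shows "pl_part (\<lambda>x. max (g x) (h x)) (\<lambda>s. max (e s) (f s))"
proof -
  have eq: "max a b = (1/2) * ((a + b) + \<bar>a + (- 1) * b\<bar>)" for a b :: real
    by (simp add: max_def)
  show ?thesis
    unfolding eq by (intro pl_part_scale pl_part_add pl_part_abs assms)
qed

lemma pl_part_const: "pl_part (\<lambda>x. k) (\<lambda>s. k)"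
  by (simp add: pl_part_def pl_funs_const)

text \<open>Finite modifications bring point indicators into the group. They later detect individual
  zeros in the double polar, yet their piecewise linear part is 0.\<close>

lemma pl_part_indicator: "pl_part (\<lambda>x. if x = y then 1 else 0) (\<lambda>s. 0)"
  by (simp add: pl_part_def pl_funs_const)

lemma pl_part_clamp: "pl_part (\<lambda>x. max 0 (min 1 (x 0))) (\<lambda>s. max 0 (min 1 s))"
  by (simp add: pl_part_def pl_funs_clamp)

lemma infinite_fibre: "infinite {x :: nat \<Rightarrow> real. x 0 = t}"
proof
  assume "finite {x :: nat \<Rightarrow> real. x 0 = t}"
  moreover have "range (\<lambda>n i. if i = 0 then t else real n) \<subseteq> {x :: nat \<Rightarrow> real. x 0 = t}" by auto
  ultimately have "finite (range (\<lambda>n i::nat. if i = 0 then t else real n))"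
    by (rule rev_finite_subset)
  moreover have "inj (\<lambda>(n::nat) i::nat. if i = 0 then t else real n)"
  proof
    fix m n :: nat
    assume "(\<lambda>i::nat. if i = 0 then t else real m) = (\<lambda>i. if i = 0 then t else real n)"
    from fun_cong[OF this, of 1] show "m = n" by simp
  qed
  ultimately show False using finite_imageD infinite_UNIV_nat by blast
qed

text \<open>Two finite exceptional sets cannot exhaust an infinite fibre. The regular point found
  over \<open>t\<close> transfers pointwise relations between group elements to their piecewise
  linear parts.\<close>

lemma pl_part_fibre:
  assumes "pl_part g e" "pl_part h f"
  obtains x where "g x = e t" "h x = f t"
proof -
  have "finite ({x. g x \<noteq> e (x 0)} \<union> {x. h x \<noteq> f (x 0)})"
    using assms by (simp add: pl_part_def)
  then have "infinite ({x. x 0 = t} - ({x. g x \<noteq> e (x 0)} \<union> {x. h x \<noteq> f (x 0)}))"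
    using infinite_fibre by (rule Diff_infinite_finite)
  then obtain x where "x \<in> {x. x 0 = t} - ({x. g x \<noteq> e (x 0)} \<union> {x. h x \<noteq> f (x 0)})"
    using infinite_imp_nonempty by blast
  then show ?thesis using that by auto
qed

lemma pl_part_unique:
  assumes "pl_part h e" "pl_part h f"
  shows "e = f"
proof
  fix t
  show "e t = f t" using pl_part_fibre[OF assms, of t] by metis
qed

text \<open>The inclusion of zero sets passes to the piecewise linear parts along the fibres, which
  gives a uniform bound off a finite set; the finitely many remaining points only enlarge the
  constant.\<close>

lemma HG_dominated:
  assumes a: "a \<in> carrier HG" and b: "b \<in> carrier HG" and zero: "\<And>x. a x = 0 \<Longrightarrow> b x = 0"
  shows "\<exists>n::nat. \<forall>x. \<bar>b x\<bar> \<le> n * \<bar>a x\<bar>"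
proof -
  obtain f g where f: "pl_part a f" and g: "pl_part b g" using a b carrier_HG by blast
  have "g t = 0" if "f t = 0" for t
    using pl_part_fibre[OF f g, of t] zero that by metis
  then obtain n :: nat where n: "\<And>s. \<bar>g s\<bar> \<le> n * \<bar>f s\<bar>"
    using pl_funs_dominated[of f g] f g unfolding pl_part_def by blast
  define E where "E = {x. a x \<noteq> f (x 0)} \<union> {x. b x \<noteq> g (x 0)}"
  have "finite E" using f g by (simp add: E_def pl_part_def)
  \<comment> \<open>Phrased for all large \<open>m\<close>, the bounds at the points of the finite
    set \<open>E\<close> can be met simultaneously, together with \<open>m \<ge> n\<close>.\<close>
  have "\<forall>\<^sub>F m in sequentially. \<bar>b x\<bar> \<le> real m * \<bar>a x\<bar>" for x
  proof (cases "a x = 0")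
    case False
    obtain k :: nat where "\<bar>b x\<bar> / \<bar>a x\<bar> \<le> k" using real_arch_simple by blast
    then have k: "\<bar>b x\<bar> \<le> k * \<bar>a x\<bar>" using False by (simp add: field_simps)
    have "\<bar>b x\<bar> \<le> real m * \<bar>a x\<bar>" if "m \<ge> k" for m
      using k mult_right_mono[of "real k" "real m" "\<bar>a x\<bar>"] that by linarith
    then show ?thesis using eventually_sequentially by blast
  qed (simp add: zero)
  then have "\<forall>\<^sub>F m in sequentially. \<forall>x \<in> E. \<bar>b x\<bar> \<le> real m * \<bar>a x\<bar>"
    using \<open>finite E\<close> by (simp add: eventually_ball_finite)
  then obtain m where m: "m \<ge> n" "\<forall>x \<in> E. \<bar>b x\<bar> \<le> real m * \<bar>a x\<bar>"
    unfolding eventually_sequentially by (meson nle_le)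
  have "\<bar>b x\<bar> \<le> m * \<bar>a x\<bar>" for x
  proof (cases "x \<in> E")
    case False
    then have "\<bar>b x\<bar> \<le> n * \<bar>a x\<bar>" using n by (auto simp: E_def)
    then show ?thesis
      using m(1) mult_right_mono[of "real n" "real m" "\<bar>a x\<bar>"] by linarith
  qed (use m in blast)
  then show ?thesis by blast
qed

section \<open>The lattice-ordered group structure, computed pointwise\<close>

lemma HG_add: "g \<in> carrier HG \<Longrightarrow> h \<in> carrier HG \<Longrightarrow> (\<lambda>x. g x + h x) \<in> carrier HG"
  using carrier_HG pl_part_add by blast

lemma HG_scale: "h \<in> carrier HG \<Longrightarrow> (\<lambda>x. k * h x) \<in> carrier HG"
  using carrier_HG pl_part_scale by blast

lemma HG_max: "g \<in> carrier HG \<Longrightarrow> h \<in> carrier HG \<Longrightarrow> (\<lambda>x. max (g x) (h x)) \<in> carrier HG"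
  using carrier_HG pl_part_max by blast

lemma HG_uminus: "g \<in> carrier HG \<Longrightarrow> (\<lambda>x. - g x) \<in> carrier HG"
  using HG_scale[of g "-1"] by simp

lemma HG_min:
  assumes "g \<in> carrier HG" "h \<in> carrier HG"
  shows "(\<lambda>x. min (g x) (h x)) \<in> carrier HG"
proof -
  have eq: "min a b = - max (- a) (- b)" for a b :: real by (simp add: min_def max_def)
  show ?thesis unfolding eq by (intro HG_uminus HG_max assms)
qed

lemma HG_const: "(\<lambda>x. k) \<in> carrier HG"
  using carrier_HG pl_part_const by blast

lemma comm_group_HG: "comm_group HG"
proof (rule comm_groupI)
  fix x assume "x \<in> carrier HG"
  then show "\<exists>y \<in> carrier HG. y \<otimes>\<^bsub>HG\<^esub> x = \<one>\<^bsub>HG\<^esub>"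
    using HG_uminus by (intro bexI[of _ "\<lambda>t. - x t"]) auto
qed (auto simp: HG_add HG_const algebra_simps)

lemma HG_least:
  assumes "g \<in> carrier HG" "h \<in> carrier HG"
  shows "least (lorder HG) (\<lambda>x. max (g x) (h x)) (Upper (lorder HG) {g, h})"
  using assms by (auto simp: least_def Upper_def lorder_def le_fun_def HG_max)

lemma HG_greatest:
  assumes "g \<in> carrier HG" "h \<in> carrier HG"
  shows "greatest (lorder HG) (\<lambda>x. min (g x) (h x)) (Lower (lorder HG) {g, h})"
  using assms by (auto simp: greatest_def Lower_def lorder_def le_fun_def HG_min)

lemma lattice_HG: "lattice (lorder HG)"
proof -
  interpret partial_order "lorder HG"
    by unfold_locales (auto simp: lorder_def)
  show ?thesis
  proof
    fix x y assume "x \<in> carrier (lorder HG)" "y \<in> carrier (lorder HG)"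
    then have xy: "x \<in> carrier HG" "y \<in> carrier HG" by (simp_all add: lorder_def)
    show "\<exists>s. least (lorder HG) s (Upper (lorder HG) {x, y})" using HG_least[OF xy] by blast
    show "\<exists>s. greatest (lorder HG) s (Lower (lorder HG) {x, y})" using HG_greatest[OF xy] by blast
  qed
qed

lemma lattice_ordered_group_HG: "lattice_ordered_group HG"
  using comm_group_HG lattice_HG
  by (simp add: lattice_ordered_group_def lattice_ordered_group_axioms_def le_fun_def)

lemma ljoin_HG:
  assumes "g \<in> carrier HG" "h \<in> carrier HG"
  shows "ljoin HG g h = (\<lambda>x. max (g x) (h x))"
proof -
  interpret lattice "lorder HG" by (rule lattice_HG)
  show ?thesis
    unfolding ljoin_def join_def sup_def
    using HG_least[OF assms] by (intro some_equality) (auto dest: least_unique)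
qed

lemma lmeet_HG:
  assumes "g \<in> carrier HG" "h \<in> carrier HG"
  shows "lmeet HG g h = (\<lambda>x. min (g x) (h x))"
proof -
  interpret lattice "lorder HG" by (rule lattice_HG)
  show ?thesis
    unfolding lmeet_def meet_def inf_def
    using HG_greatest[OF assms] by (intro some_equality) (auto dest: greatest_unique)
qed

lemma inv_HG:
  assumes "h \<in> carrier HG"
  shows "inv\<^bsub>HG\<^esub> h = (\<lambda>x. - h x)"
proof -
  interpret comm_group HG by (rule comm_group_HG)
  show ?thesis using assms HG_uminus by (intro inv_equality) auto
qed

lemma labs_HG:
  assumes "h \<in> carrier HG"
  shows "labs HG h = (\<lambda>x. \<bar>h x\<bar>)"
  using assms by (simp add: labs_def inv_HG ljoin_HG HG_uminus) (auto simp: fun_eq_iff)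

lemma HG_abs: "h \<in> carrier HG \<Longrightarrow> (\<lambda>x. \<bar>h x\<bar>) \<in> carrier HG"
  using carrier_HG pl_part_abs by blast

lemma pow_HG: "h [^]\<^bsub>HG\<^esub> (n::nat) = (\<lambda>x. n * h x)"
proof (induction n)
  case 0
  show ?case by (simp add: nat_pow_def)
next
  case (Suc n)
  then show ?case by (simp add: nat_pow_def algebra_simps)
qed

section \<open>The archimedean property, the strong unit and property (M)\<close>

lemma archimedean_HG: "archimedean HG"
  unfolding archimedean_def
proof (intro ballI impI)
  fix a b
  assume "\<one>\<^bsub>HG\<^esub> \<preceq>\<^bsub>HG\<^esub> a \<and> \<one>\<^bsub>HG\<^esub> \<preceq>\<^bsub>HG\<^esub> b \<and> (\<forall>n::nat. a [^]\<^bsub>HG\<^esub> n \<preceq>\<^bsub>HG\<^esub> b)"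
  then have a: "\<And>x. 0 \<le> a x" and b: "\<And>n x. real n * a x \<le> b x"
    by (simp_all add: pow_HG le_fun_def)
  have "a x = 0" for x
  proof (rule ccontr)
    assume "a x \<noteq> 0"
    then have "0 < a x" using a[of x] by simp
    then obtain n :: nat where "b x < n * a x" using reals_Archimedean3 by blast
    then show False using b[of n x] by simp
  qed
  then show "a = \<one>\<^bsub>HG\<^esub>" by (simp add: fun_eq_iff)
qed

text \<open>The constant 1 has no zeros, so boundedness of every element is an instance of
  \<open>HG_dominated\<close>.\<close>

lemma strong_unit_HG: "strong_unit HG (\<lambda>x. 1)"
proof -
  have "h \<in> principal_convex HG (\<lambda>x. 1)" if "h \<in> carrier HG" for h
    using HG_dominated[of "\<lambda>x. 1" h] that HG_const
    by (simp add: principal_convex_def labs_HG pow_HG le_fun_def)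
  then show ?thesis
    using HG_const by (auto simp: strong_unit_def principal_convex_def le_fun_def)
qed

text \<open>Translates convexity into pointwise domination: \<open>K\<close> contains
  \<open>\<bar>g\<bar>\<close> as the join of \<open>g\<close> and its inverse, hence its multiples
  and their negatives, and \<open>h\<close> is squeezed between these.\<close>

lemma convex_lsubgroup_HG:
  assumes K: "convex_lsubgroup K HG"
  shows convex_HG_carrier: "K \<subseteq> carrier HG"
    and convex_HG_add: "g \<in> K \<Longrightarrow> h \<in> K \<Longrightarrow> (\<lambda>x. g x + h x) \<in> K"
    and convex_HG_dominated:
      "g \<in> K \<Longrightarrow> h \<in> carrier HG \<Longrightarrow> (\<And>x. \<bar>h x\<bar> \<le> real n * \<bar>g x\<bar>) \<Longrightarrow> h \<in> K"
proof -
  interpret comm_group HG by (rule comm_group_HG)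
  have sub: "subgroup K HG" using K by (simp add: convex_lsubgroup_def)
  interpret subgroup K HG by (rule sub)
  show carr: "K \<subseteq> carrier HG" by (rule subset)
  show add: "(\<lambda>x. g x + h x) \<in> K" if "g \<in> K" "h \<in> K" for g h
    using m_closed[OF that] by simp
  assume g: "g \<in> K" and h: "h \<in> carrier HG" and dom: "\<And>x. \<bar>h x\<bar> \<le> real n * \<bar>g x\<bar>"
  have gc: "g \<in> carrier HG" using g carr by blast
  have "ljoin HG g (inv\<^bsub>HG\<^esub> g) \<in> K"
    using K g m_inv_closed[OF g] unfolding convex_lsubgroup_def by blast
  then have "labs HG g \<in> K" by (simp only: labs_def)
  then have abs: "(\<lambda>x. \<bar>g x\<bar>) \<in> K" by (simp add: labs_HG gc)
  have pos: "(\<lambda>x. real n * \<bar>g x\<bar>) \<in> K"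
  proof (induction n)
    case 0
    show ?case using one_closed by simp
  next
    case (Suc n)
    from add[OF this abs] show ?case by (simp add: algebra_simps)
  qed
  have neg: "(\<lambda>x. - (real n * \<bar>g x\<bar>)) \<in> K"
    using m_inv_closed[OF pos] carr pos by (simp add: inv_HG subset_iff)
  have "(\<lambda>x. - (real n * \<bar>g x\<bar>)) \<le> h" "h \<le> (\<lambda>x. real n * \<bar>g x\<bar>)"
    using dom unfolding le_fun_def by (metis abs_le_D2 minus_le_iff, metis abs_le_D1)
  then show "h \<in> K"
    using K pos neg h unfolding convex_lsubgroup_def HG_simps by blast
qed

lemma property_M_HG: "property_M HG"
  unfolding property_M_def
proof (intro allI impI ballI subsetI)
  fix K a b
  assume K: "convex_lsubgroup K HG" and a: "a \<in> K" and b: "b \<in> polar HG (polar HG {a})"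
  have ac: "a \<in> carrier HG" using a convex_HG_carrier[OF K] by blast
  have bc: "b \<in> carrier HG" using b by (simp add: polar_def)
  have "b y = 0" if "a y = 0" for y
  proof -
    let ?d = "\<lambda>x. if x = y then 1 else 0 :: real"
    have dc: "?d \<in> carrier HG" using carrier_HG pl_part_indicator by blast
    \<comment> \<open>As \<open>a\<close> vanishes at \<open>y\<close>, the indicator of
      \<open>y\<close> is disjoint from \<open>a\<close>, hence from everything in the double polar;
      being 1 at \<open>y\<close>, it forces \<open>b y = 0\<close>.\<close>
    have "?d \<in> polar HG {a}"
      using that dc ac by (auto simp: polar_def labs_HG lmeet_HG HG_abs)
    then have "lmeet HG (labs HG b) (labs HG ?d) = (\<lambda>x. 0)"
      using b by (simp add: polar_def)
    then have "(\<lambda>x. min \<bar>b x\<bar> \<bar>?d x\<bar>) = (\<lambda>x. 0)"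
      using bc dc by (simp add: labs_HG lmeet_HG HG_abs)
    from fun_cong[OF this, of y] show ?thesis by (simp add: min_def split: if_splits)
  qed
  then obtain n :: nat where "\<And>x. \<bar>b x\<bar> \<le> n * \<bar>a x\<bar>" using HG_dominated[OF ac bc] by blast
  then show "b \<in> K" by (rule convex_HG_dominated[OF K a bc])
qed


section \<open>An arc in the Yosida space\<close>

text \<open>The kernel of evaluating the piecewise linear part, rather than \<open>h\<close> itself,
  at \<open>t\<close>. It is constant in \<open>t\<close> on either side of the unit interval, so
  the whole real line can parametrise the arc.\<close>

definition point_value :: "real \<Rightarrow> ((nat \<Rightarrow> real) \<Rightarrow> real) set" where
  "point_value t = {h. \<exists>f. pl_part h f \<and> f t = 0}"

lemma point_value_iff: "pl_part h f \<Longrightarrow> h \<in> point_value t \<longleftrightarrow> f t = 0"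
  unfolding point_value_def using pl_part_unique by blast

lemma pl_part_mono:
  assumes "pl_part g e" "pl_part h f" "g \<le> h"
  shows "e t \<le> f t"
  using pl_part_fibre[OF assms(1,2), of t] assms(3) by (metis le_funD)

lemma pl_part_uminus: "pl_part h f \<Longrightarrow> pl_part (\<lambda>x. - h x) (\<lambda>s. - f s)"
  using pl_part_scale[of h f "-1"] by simp

lemma pl_part_min:
  assumes "pl_part g e" "pl_part h f"
  shows "pl_part (\<lambda>x. min (g x) (h x)) (\<lambda>s. min (e s) (f s))"
proof -
  have eq: "min a b = - max (- a) (- b)" for a b :: real by (simp add: min_def max_def)
  show ?thesis unfolding eq by (intro pl_part_uminus pl_part_max assms)
qed

text \<open>Taking the piecewise linear part and evaluating it at \<open>t\<close> is a
  lattice-ordered group homomorphism to the reals; this is its kernel.\<close>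

lemma convex_point_value: "convex_lsubgroup (point_value t) HG"
proof -
  interpret comm_group HG by (rule comm_group_HG)
  have sub: "point_value t \<subseteq> carrier HG" unfolding point_value_def by (auto simp: carrier_HG)
  have "subgroup (point_value t) HG"
  proof
    show "point_value t \<subseteq> carrier HG" by (rule sub)
    show "\<one>\<^bsub>HG\<^esub> \<in> point_value t" using pl_part_const[of 0] by (simp add: point_value_iff)
    show "g \<otimes>\<^bsub>HG\<^esub> h \<in> point_value t" if "g \<in> point_value t" "h \<in> point_value t" for g h
      using that pl_part_add unfolding point_value_def by fastforce
    show "inv\<^bsub>HG\<^esub> h \<in> point_value t" if "h \<in> point_value t" for h
      using that sub pl_part_uminus unfolding point_value_def by (fastforce simp: inv_HG carrier_HG)
  qed
  moreover have "lmeet HG g h \<in> point_value t \<and> ljoin HG g h \<in> point_value t"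
    if gh: "g \<in> point_value t" "h \<in> point_value t" for g h
  proof -
    obtain e f where ef: "pl_part g e" "pl_part h f" "e t = 0" "f t = 0"
      using gh unfolding point_value_def by blast
    have "g \<in> carrier HG" "h \<in> carrier HG" using gh sub by auto
    then show ?thesis
      using point_value_iff[OF pl_part_min[OF ef(1,2)]] point_value_iff[OF pl_part_max[OF ef(1,2)]]
      by (simp add: lmeet_HG ljoin_HG ef)
  qed
  moreover have "k \<in> point_value t"
    if gh: "g \<in> point_value t" "h \<in> point_value t" and k: "k \<in> carrier HG" "g \<le> k" "k \<le> h" for g h k
  proof -
    obtain e f where ef: "pl_part g e" "pl_part h f" "e t = 0" "f t = 0"
      using gh unfolding point_value_def by blast
    obtain d where d: "pl_part k d" using k(1) carrier_HG by blast
    have "d t = 0"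
      using pl_part_mono[OF ef(1) d k(2), of t] pl_part_mono[OF d ef(2) k(3), of t] ef by simp
    then show ?thesis using d by (simp add: point_value_iff)
  qed
  ultimately show ?thesis unfolding convex_lsubgroup_def HG_simps by blast
qed

text \<open>The quotient by \<open>point_value t\<close> is the real line, which has no proper
  nonzero convex subgroup. The proof carries this out with elements.\<close>

lemma point_value_in_values: "point_value t \<in> group_values HG (\<lambda>x. 1)"
proof -
  have one: "(\<lambda>x. 1) \<notin> point_value t" using pl_part_const[of 1] by (simp add: point_value_iff)
  have "q = point_value t"
    if q: "convex_lsubgroup q HG" "(\<lambda>x. 1) \<notin> q" "point_value t \<subseteq> q" for q
  proof (rule ccontr)
    assume "q \<noteq> point_value t"
    then obtain h where h: "h \<in> q" "h \<notin> point_value t" using q(3) by blast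
    then have hc: "h \<in> carrier HG" using convex_HG_carrier[OF q(1)] by blast
    then obtain f where f: "pl_part h f" using carrier_HG by blast
    then have "f t \<noteq> 0" using h(2) by (simp add: point_value_iff)
    then obtain n :: nat where n: "1 < n * \<bar>f t\<bar>" using reals_Archimedean3[of "\<bar>f t\<bar>"] by auto
    \<comment> \<open>\<open>1 \<le> (1 - n \<bar>h\<bar>)\<^sup>+ + n \<bar>h\<bar>\<close>, where the first summand vanishes at \<open>t\<close>.\<close>
    define k where "k = (\<lambda>x. max 0 (1 + (- real n) * \<bar>h x\<bar>))"
    have "pl_part k (\<lambda>s. max 0 (1 + (- real n) * \<bar>f s\<bar>))"
      unfolding k_def by (intro pl_part_max pl_part_add pl_part_scale pl_part_abs pl_part_const f)
    then have "k \<in> q" using n q(3) point_value_iff by fastforce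
    moreover have nh: "(\<lambda>x. real n * \<bar>h x\<bar>) \<in> q"
      by (rule convex_HG_dominated[OF q(1) h(1) HG_scale[OF HG_abs[OF hc]], of _ n])
        (simp add: abs_mult)
    ultimately have sum: "(\<lambda>x. k x + real n * \<bar>h x\<bar>) \<in> q" by (rule convex_HG_add[OF q(1)])
    have "(\<lambda>x. 1) \<in> q"
      by (rule convex_HG_dominated[OF q(1) sum HG_const, of _ 1]) (simp add: k_def)
    then show False using q(2) by blast
  qed
  then show ?thesis using one convex_point_value by (auto simp: group_values_def)
qed

section \<open>Continuity of the arc and failure of zero-dimensionality\<close>

lemma openin_yosida_basic:
  "a \<in> carrier HG \<Longrightarrow> openin (yosida_space HG v) {p \<in> group_values HG v. a \<notin> p}"
  unfolding yosida_space_def by (intro topology_generated_by_Basis) blast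

text \<open>The preimage of the generator given by \<open>a\<close> is the set where the piecewise
  linear part of \<open>a\<close> is nonzero, open by continuity.\<close>

lemma continuous_point_value:
  "continuous_map euclidean (yosida_space HG (\<lambda>x. 1)) point_value"
  unfolding yosida_space_def
proof (rule continuous_on_generated_topo)
  show "point_value ` topspace euclidean
      \<subseteq> \<Union> {{p \<in> group_values HG (\<lambda>x. 1). a \<notin> p} | a. a \<in> carrier HG}"
  \<comment> \<open>The generator of the constant 1 covers everything, since no value contains
    1.\<close>
  proof (intro image_subsetI UnionI)
    show "{p \<in> group_values HG (\<lambda>x. 1). (\<lambda>x. 1) \<notin> p}
        \<in> {{p \<in> group_values HG (\<lambda>x. 1). a \<notin> p} | a. a \<in> carrier HG}"
      using HG_const[of 1] by blast
    show "point_value t \<in> {p \<in> group_values HG (\<lambda>x. 1). (\<lambda>x. 1) \<notin> p}" for t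
      using point_value_in_values by (simp add: group_values_def)
  qed
  fix U
  assume "U \<in> {{p \<in> group_values HG (\<lambda>x. 1). a \<notin> p} | a. a \<in> carrier HG}"
  then obtain a where U: "U = {p \<in> group_values HG (\<lambda>x. 1). a \<notin> p}" and "a \<in> carrier HG" by blast
  then obtain f where f: "pl_part a f" using carrier_HG by blast
  then have "point_value -` U = {t. f t \<noteq> 0}"
    using point_value_in_values by (auto simp: U point_value_iff)
  moreover have "continuous_on UNIV f"
    using f piecewise_linear_isCont
    by (auto simp: pl_part_def pl_funs_def intro: continuous_at_imp_continuous_on)
  then have "open {t. f t \<noteq> 0}"
    by (intro open_Collect_neq continuous_on_const)
  ultimately show "openin euclidean (point_value -` U \<inter> topspace euclidean)" by simp
qed

lemma not_zero_dimensional_HG: "\<not> zero_dimensional (yosida_space HG (\<lambda>x. 1))"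
proof
  let ?Y = "yosida_space HG (\<lambda>x. 1)"
  assume "zero_dimensional ?Y"
  then obtain \<B> where clopen: "\<And>U. U \<in> \<B> \<Longrightarrow> openin ?Y U \<and> closedin ?Y U"
    and base: "openin ?Y = arbitrary union_of (\<lambda>U. U \<in> \<B>)"
    unfolding zero_dimensional_def by blast
  \<comment> \<open>The clamped coordinate is 0 at 0 and 1 at 1, so its basic open set
    \<open>U\<close> separates the two ends of the arc. A clopen \<open>B\<close> inside
    \<open>U\<close> then pulls back to a clopen subset of the line containing 1 but not 0.\<close>
  define a where "a = (\<lambda>x :: nat \<Rightarrow> real. max 0 (min 1 (x 0)))"
  define U where "U = {p \<in> group_values HG (\<lambda>x. 1). a \<notin> p}"
  have a: "pl_part a (\<lambda>s. max 0 (min 1 s))" unfolding a_def by (rule pl_part_clamp)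
  have "openin ?Y U" unfolding U_def using a carrier_HG openin_yosida_basic by blast
  moreover have in1: "point_value 1 \<in> U" and out0: "point_value 0 \<notin> U"
    using point_value_iff[OF a] point_value_in_values by (auto simp: U_def)
  ultimately obtain B where B: "B \<in> \<B>" "point_value 1 \<in> B" "B \<subseteq> U"
    unfolding base by (auto simp: union_of_def arbitrary_def)
  have "open (point_value -` B)"
    using openin_continuous_map_preimage[OF continuous_point_value] clopen[OF B(1)]
    by (fastforce simp: vimage_def)
  moreover have "closed (point_value -` B)"
    using closedin_continuous_map_preimage[OF continuous_point_value] clopen[OF B(1)]
    by (fastforce simp: vimage_def)
  ultimately have "point_value -` B = {} \<or> point_value -` B = UNIV"
    using connected_UNIV[unfolded connected_clopen] by auto
  then show False using B in1 out0 by auto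
qed

theorem mainTheorem12:
  shows "\<exists>(H :: ((nat \<Rightarrow> real) \<Rightarrow> real) lgroup) v.
    lattice_ordered_group H \<and> archimedean H \<and> strong_unit H v \<and> property_M H \<and>
    \<not> zero_dimensional (yosida_space H v)"
  using lattice_ordered_group_HG archimedean_HG strong_unit_HG property_M_HG
    not_zero_dimensional_HG by blast

end
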